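(* Let $q$ be a prime power and $d\ge 2$. Let $f,g:\mathbb{F}_q^d\to\mathbb{F}_q$ be the linear bipermutive local rules $f(x_0,\dots,x_{d-1})=a_0x_0+\dots+a_{d-1}x_{d-1}$ and $g(x_0,\dots,x_{d-1})=b_0x_0+\dots+b_{d-1}x_{d-1}$ (so $a_0,a_{d-1},b_0,b_{d-1}\neq 0$), and let $F,G:\mathbb{F}_q^{2(d-1)}\to\mathbb{F}_q^{d-1}$ be the no-boundary cellular automata of length $2(d-1)$ defined by $f$ and $g$. Then the Latin squares $L_F$ and $L_G$ of order $q^{d-1}$ generated by $F$ and $G$ are orthogonal if and only if the polynomials $p_f(X)=a_0+a_1X+\dots+a_{d-1}X^{d-1}$ and $p_g(X)=b_0+b_1X+\dots+b_{d-1}X^{d-1}$ in $\mathbb{F}_q[X]$ are relatively prime.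
   Context: For $n\ge d$, the no-boundary cellular automaton $F:A^n\to A^{n-d+1}$ of length $n$ with local rule $f:A^d\to A$ is $F(x_0,\dots,x_{n-1})=(f(x_0,\dots,x_{d-1}),\dots,f(x_{n-d},\dots,x_{n-1}))$. A linear rule $f=\sum a_ix_i$ over $\mathbb{F}_q$ is bipermutive iff $a_0\ne0$ and $a_{d-1}\ne0$. Fix a bijection $\phi:\mathbb{F}_q^{d-1}\to\{1,\dots,q^{d-1}\}$ with inverse $\psi$; the Latin square generated by $F:\mathbb{F}_q^{2(d-1)}\to\mathbb{F}_q^{d-1}$ is the $q^{d-1}\times q^{d-1}$ matrix $L_F(i,j)=\phi(F(\psi(i)\|\psi(j)))$, where $\|$ is concatenation. Two Latin squares $L_1,L_2$ of order $N$ are orthogonal if the pairs $(L_1(i,j),L_2(i,j))$, $(i,j)\in[N]^2$, are pairwise distinct. *)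

theory Defs
  imports "HOL-Computational_Algebra.Polynomial" "HOL-Library.Cardinality"
begin

text \<open>A configuration in \<open>A\<^sup>n\<close> is a list of length \<open>n\<close> over the type \<open>A\<close>. Rules and automata are
  functions on all lists, of which only the values on lists of the intended length matter.\<close>

definition no_boundary_ca :: "nat \<Rightarrow> nat \<Rightarrow> ('a list \<Rightarrow> 'a) \<Rightarrow> 'a list \<Rightarrow> 'a list" where
  "no_boundary_ca n d f x = map (\<lambda>i. f (take d (drop i x))) [0..<n - d + 1]"

definition bipermutive :: "nat \<Rightarrow> ('a list \<Rightarrow> 'a) \<Rightarrow> bool" where
  "bipermutive d f \<longleftrightarrow>
     (\<forall>u. length u = d - 1 \<longrightarrow> bij (\<lambda>x. f (x # u)) \<and> bij (\<lambda>x. f (u @ [x])))"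

definition linear_rule :: "nat \<Rightarrow> (nat \<Rightarrow> 'a::field) \<Rightarrow> 'a list \<Rightarrow> 'a" where
  "linear_rule d a x = (\<Sum>i<d. a i * x ! i)"

definition rule_poly :: "nat \<Rightarrow> (nat \<Rightarrow> 'a::field) \<Rightarrow> 'a poly" where
  "rule_poly d a = (\<Sum>i<d. monom (a i) i)"

definition latin_square :: "nat \<Rightarrow> (nat \<Rightarrow> nat \<Rightarrow> nat) \<Rightarrow> bool" where
  "latin_square N L \<longleftrightarrow>
     (\<forall>i\<in>{1..N}. bij_betw (\<lambda>j. L i j) {1..N} {1..N}) \<and>
     (\<forall>j\<in>{1..N}. bij_betw (\<lambda>i. L i j) {1..N} {1..N})"

definition orthogonal_latin_squares ::
    "nat \<Rightarrow> (nat \<Rightarrow> nat \<Rightarrow> nat) \<Rightarrow> (nat \<Rightarrow> nat \<Rightarrow> nat) \<Rightarrow> bool" where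
  "orthogonal_latin_squares N L1 L2 \<longleftrightarrow> latin_square N L1 \<and> latin_square N L2 \<and>
     inj_on (\<lambda>(i, j). (L1 i j, L2 i j)) ({1..N} \<times> {1..N})"

definition generated_square ::
    "nat \<Rightarrow> ('a list \<Rightarrow> nat) \<Rightarrow> ('a list \<Rightarrow> 'a list) \<Rightarrow> nat \<Rightarrow> nat \<Rightarrow> nat" where
  "generated_square m \<phi> F i j =
     (let \<psi> = inv_into {x. length x = m} \<phi> in \<phi> (F (\<psi> i @ \<psi> j)))"

lemma bij_affine_iff:
  fixes c e :: "'a::field"
  shows "bij (\<lambda>x. c * x + e) \<longleftrightarrow> c \<noteq> 0"
proof
  assume "bij (\<lambda>x. c * x + e)"
  then have "c * 0 + e \<noteq> c * 1 + e"
    using bij_is_inj inj_eq zero_neq_one by (metis (mono_tags, lifting))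
  then show "c \<noteq> 0" by auto
next
  assume "c \<noteq> 0"
  then show "bij (\<lambda>x. c * x + e)"
    by (intro bij_betw_byWitness[where f' = "\<lambda>y. (y - e) / c"]) auto
qed

lemma bipermutive_linear_rule_iff:
  fixes a :: "nat \<Rightarrow> 'a::field"
  assumes "d \<ge> 2"
  shows "bipermutive d (linear_rule d a) \<longleftrightarrow> a 0 \<noteq> 0 \<and> a (d - 1) \<noteq> 0"
proof -
  obtain m where d: "d = Suc m" using assms by (cases d) auto
  have left: "linear_rule d a (x # u) = a 0 * x + (\<Sum>i<m. a (Suc i) * u ! i)" for x u
    unfolding linear_rule_def d by (simp add: sum.lessThan_Suc_shift del: sum.lessThan_Suc)
  have right: "linear_rule d a (u @ [x]) = a m * x + (\<Sum>i<m. a i * u ! i)"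
    if "length u = m" for x u
    unfolding linear_rule_def d using that by (simp add: nth_append add.commute)
  have "\<exists>u::'a list. length u = m" by (rule exI[of _ "replicate m 0"]) simp
  then show ?thesis
    unfolding bipermutive_def using left right by (auto simp: bij_affine_iff d)
qed

lemma nth_no_boundary_ca_append:
  assumes "length y = m" "length z = m" "k < m"
  shows "no_boundary_ca (2 * m) (Suc m) f (y @ z) ! k = f (drop k y @ take (Suc k) z)"
proof -
  have "Suc m - (m - k) = Suc k" using assms by simp
  then show ?thesis using assms
    by (simp add: no_boundary_ca_def Suc_diff_le nth_append del: upt_Suc)
qed

lemma length_no_boundary_ca:
  "m \<ge> 1 \<Longrightarrow> length (no_boundary_ca (2 * m) (Suc m) f x) = m"
  by (simp add: no_boundary_ca_def)

lemma no_boundary_ca_inj_right: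
  assumes f: "bipermutive (Suc m) f" and len: "length y = m" "length z = m" "length z' = m"
    and eq: "no_boundary_ca (2 * m) (Suc m) f (y @ z) = no_boundary_ca (2 * m) (Suc m) f (y @ z')"
  shows "z = z'"
proof -
  have "take k z = take k z'" if "k \<le> m" for k
    using that
  proof (induction k)
    case (Suc k)
    then have k: "k < m" and IH: "take k z = take k z'" by auto
    have "f ((drop k y @ take k z) @ [z ! k]) = f ((drop k y @ take k z) @ [z' ! k])"
      using nth_no_boundary_ca_append[of y m z k f] nth_no_boundary_ca_append[of y m z' k f]
        len eq k IH by (simp add: take_Suc_conv_app_nth)
    moreover have "inj (\<lambda>x. f ((drop k y @ take k z) @ [x]))"
      using f[unfolded bipermutive_def, rule_format, of "drop k y @ take k z"] k len
      by (simp add: bij_is_inj)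
    ultimately have "z ! k = z' ! k" by (meson injD)
    then show ?case using IH k len by (simp add: take_Suc_conv_app_nth)
  qed simp
  from this[of m] show ?thesis using len by simp
qed

lemma no_boundary_ca_inj_left:
  assumes f: "bipermutive (Suc m) f" and len: "length y = m" "length y' = m" "length z = m"
    and eq: "no_boundary_ca (2 * m) (Suc m) f (y @ z) = no_boundary_ca (2 * m) (Suc m) f (y' @ z)"
  shows "y = y'"
proof -
  have "drop k y = drop k y'" if "k \<le> m" for k
    using that
  proof (induction k rule: inc_induct)
    case (step k)
    then have k: "k < m" and IH: "drop (Suc k) y = drop (Suc k) y'" by auto
    let ?u = "drop (Suc k) y @ take (Suc k) z"
    have dk: "drop k y = y ! k # drop (Suc k) y" "drop k y' = y' ! k # drop (Suc k) y'"
      using k len by (simp_all add: Cons_nth_drop_Suc)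
    have "f (y ! k # ?u) = f (y' ! k # ?u)"
      using nth_no_boundary_ca_append[of y m z k f] nth_no_boundary_ca_append[of y' m z k f]
        len eq k IH dk by simp
    moreover have "inj (\<lambda>x. f (x # ?u))"
      using f k len unfolding bipermutive_def by (intro bij_is_inj) auto
    ultimately have "y ! k = y' ! k" by (meson injD)
    then show ?case using IH dk by simp
  qed (use len in simp)
  from this[of 0] show ?thesis by simp
qed

lemma latin_square_generated_square:
  fixes f :: "'a::finite list \<Rightarrow> 'a"
  assumes d: "d \<ge> 2" and f: "bipermutive d f"
    and \<phi>: "bij_betw \<phi> {x :: 'a list. length x = d - 1} {1..N}"
  shows "latin_square N (generated_square (d - 1) \<phi> (no_boundary_ca (2 * (d - 1)) d f))"
proof -
  define m where "m = d - 1"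
  have dm: "d = Suc m" and m: "m \<ge> 1" using d by (auto simp: m_def)
  let ?W = "{x :: 'a list. length x = m}"
  let ?F = "no_boundary_ca (2 * m) (Suc m) f"
  define \<psi> where "\<psi> = inv_into ?W \<phi>"
  have \<phi>': "bij_betw \<phi> ?W {1..N}" using \<phi> by (simp add: m_def)
  have \<psi>: "bij_betw \<psi> {1..N} ?W" unfolding \<psi>_def by (rule bij_betw_inv_into[OF \<phi>'])
  have fin: "finite ?W" using finite_lists_length_eq[of "UNIV :: 'a set" m] by simp
  have bij: "bij_betw h ?W ?W" if "inj_on h ?W" "h ` ?W \<subseteq> ?W" for h
    using endo_inj_surj[OF fin that(2,1)] that(1) by (simp add: bij_betw_def)
  have W: "length (\<psi> i) = m" if "i \<in> {1..N}" for i
    using bij_betw_apply[OF \<psi> that] by simp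
  have row: "bij_betw (\<lambda>j. \<phi> (?F (\<psi> i @ \<psi> j))) {1..N} {1..N}" if i: "i \<in> {1..N}" for i
  proof -
    have "bij_betw (\<lambda>z. ?F (\<psi> i @ z)) ?W ?W"
      using no_boundary_ca_inj_right[OF f[unfolded dm] W[OF i]] length_no_boundary_ca[OF m, of f]
      by (intro bij inj_onI) auto
    from bij_betw_trans[OF bij_betw_trans[OF \<psi> this] \<phi>'] show ?thesis by (simp add: o_def)
  qed
  have col: "bij_betw (\<lambda>i. \<phi> (?F (\<psi> i @ \<psi> j))) {1..N} {1..N}" if j: "j \<in> {1..N}" for j
  proof -
    have "bij_betw (\<lambda>y. ?F (y @ \<psi> j)) ?W ?W"
      using no_boundary_ca_inj_left[OF f[unfolded dm] _ _ W[OF j]] length_no_boundary_ca[OF m, of f]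
      by (intro bij inj_onI) auto
    from bij_betw_trans[OF bij_betw_trans[OF \<psi> this] \<phi>'] show ?thesis by (simp add: o_def)
  qed
  show ?thesis
    using row col unfolding latin_square_def generated_square_def Let_def
    by (simp add: dm \<psi>_def)
qed

end

theory Submission
  imports Defs
begin

text \<open>A configuration \<open>x\<close> of length \<open>2 (d - 1)\<close> acts as a linear functional on the polynomials of
  degree less than \<open>2 (d - 1)\<close>, and the \<open>k\<close>-th cell of \<open>F x\<close> is its value at \<open>X\<^sup>k p\<^sub>f\<close>. Hence
  \<open>(F x, G x)\<close> determines the functional on all \<open>u p\<^sub>f + v p\<^sub>g\<close> with \<open>u, v\<close> of degree less than
  \<open>d - 1\<close>. If \<open>p\<^sub>f\<close> and \<open>p\<^sub>g\<close> are coprime, these are all polynomials of degree less than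
  \<open>2 (d - 1)\<close>, so \<open>x\<close> is determined. If they have a common factor \<open>h\<close> of degree \<open>e > 0\<close>, the
  functional sending \<open>p\<close> to the coefficient of \<open>X\<^sup>e\<^sup>-\<^sup>1\<close> in \<open>p mod h\<close> comes from a nonzero
  configuration on which both automata vanish.\<close>

section \<open>Bezout identities with degree bounds\<close>

text \<open>In the ideal \<open>I\<close> generated by \<open>p\<close> and \<open>q\<close>, a
  nonzero element of least degree divides every element, by division with remainder. It is thus a
  common divisor of the generators, hence a unit, which puts 1 into \<open>I\<close>.\<close>

lemma coprime_poly_bezout:
  fixes p q :: "'a::field poly"
  assumes "coprime p q"
  obtains u v where "u * p + v * q = 1"
proof -
  define I where "I = {u * p + v * q | u v. True}"
  have I: "p \<in> I" "q \<in> I" "\<And>r s. r \<in> I \<Longrightarrow> s \<in> I \<Longrightarrow> r + s \<in> I" "\<And>c r. r \<in> I \<Longrightarrow> c * r \<in> I"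
  proof -
    have "1 * p + 0 * q \<in> I" "0 * p + 1 * q \<in> I" unfolding I_def by blast+
    then show "p \<in> I" "q \<in> I" by simp_all
    show "r + s \<in> I" if rs: "r \<in> I" "s \<in> I" for r s
    proof -
      obtain u v u' v' where "r = u * p + v * q" "s = u' * p + v' * q"
        using rs unfolding I_def by blast
      then have "r + s = (u + u') * p + (v + v') * q" by (simp add: algebra_simps)
      then show ?thesis unfolding I_def by blast
    qed
    show "c * r \<in> I" if r: "r \<in> I" for c r
    proof -
      obtain u v where "r = u * p + v * q" using r unfolding I_def by blast
      then have "c * r = (c * u) * p + (c * v) * q" by (simp add: algebra_simps)
      then show ?thesis unfolding I_def by blast
    qed
  qed
  have "p \<noteq> 0 \<or> q \<noteq> 0" using assms by auto
  then have "\<exists>h. h \<in> I \<and> h \<noteq> 0" using I(1,2) by blast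
  from ex_has_least_nat[of "\<lambda>h. h \<in> I \<and> h \<noteq> 0", OF this[THEN someI_ex], of degree]
  obtain h where h: "h \<in> I" "h \<noteq> 0"
    and least: "\<And>r. r \<in> I \<Longrightarrow> r \<noteq> 0 \<Longrightarrow> degree h \<le> degree r"
    by blast
  have "h dvd r" if r: "r \<in> I" for r
  proof -
    \<comment> \<open>The remainder lies in \<open>I\<close>; if nonzero, it would have smaller
      degree than \<open>h\<close>, against minimality.\<close>
    have "r + - (r div h) * h = r mod h"
      using minus_div_mult_eq_mod[of r h] by simp
    then have "r mod h \<in> I" using I(3)[OF r I(4)[OF h(1), of "- (r div h)"]] by simp
    then show ?thesis using degree_mod_less'[OF h(2), of r] least[of "r mod h"]
      by (fastforce simp: dvd_eq_mod_eq_0)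
  qed
  then have "is_unit h" using assms I(1,2) coprime_common_divisor by blast
  then obtain c where "1 = h * c" by (rule dvdE)
  then have "1 \<in> I" using I(4)[OF h(1), of c] by (simp add: mult.commute)
  then obtain u v where "1 = u * p + v * q" unfolding I_def by blast
  then show ?thesis using that by simp
qed

text \<open>After scaling a Bezout identity by \<open>r\<close>, the coefficient of \<open>q\<close>
  is reduced modulo \<open>p\<close> and the quotient moves to the coefficient of \<open>p\<close>,
  whose bound then follows by comparing degrees. As the zero polynomial has degree 0, the guard on
  \<open>u\<close> covers constant \<open>q\<close>.\<close>

lemma coprime_poly_bezout_degree:
  fixes p q r :: "'a::field poly"
  assumes "coprime p q" and "degree p > 0" and "degree r < degree p + degree q"
  obtains u v where "u * p + v * q = r" "u \<noteq> 0 \<longrightarrow> degree u < degree q" "degree v < degree p"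
proof -
  obtain u v where uv: "u * p + v * q = 1" using assms(1) by (rule coprime_poly_bezout)
  define v' where "v' = (r * v) mod p"
  define u' where "u' = r * u + ((r * v) div p) * q"
  have "u' * p + v' * q = r * u * p + ((r * v) div p * p + (r * v) mod p) * q"
    unfolding u'_def v'_def by (simp only: algebra_simps)
  also have "\<dots> = r * (u * p + v * q)" by (simp only: div_mult_mod_eq) (simp add: algebra_simps)
  finally have eq: "u' * p + v' * q = r" using uv by simp
  have p: "p \<noteq> 0" using assms(2) by auto
  have v': "degree v' < degree p"
    using degree_mod_less[OF p, of "r * v"] assms(2) unfolding v'_def by auto
  have "degree (v' * q) < degree p + degree q"
    using degree_mult_le[of v' q] v' by linarith
  moreover have "u' * p = r - v' * q" using eq by (simp add: algebra_simps)
  ultimately have "degree (u' * p) < degree p + degree q"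
    using assms(3) by (simp add: degree_diff_less)
  then have "u' \<noteq> 0 \<longrightarrow> degree u' < degree q" using p by (auto simp: degree_mult_eq)
  with eq v' that show ?thesis by blast
qed

section \<open>Configurations as functionals on polynomials\<close>

lemma coeff_rule_poly: "coeff (rule_poly d a) i = (if i < d then a i else 0)"
  by (simp add: rule_poly_def coeff_sum)

lemma degree_rule_poly:
  assumes "a m \<noteq> 0"
  shows "degree (rule_poly (Suc m) a) = m"
  using assms by (intro antisym degree_le le_degree) (auto simp: coeff_rule_poly)

text \<open>The linear functional with value \<open>x ! i\<close> at \<open>monom 1 i\<close>;
  coefficients from position \<open>length x\<close> on are ignored.\<close>

definition poly_pairing :: "'a::field list \<Rightarrow> 'a poly \<Rightarrow> 'a" where
  "poly_pairing x p = (\<Sum>i<length x. coeff p i * x ! i)"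

lemma poly_pairing_add: "poly_pairing x (p + q) = poly_pairing x p + poly_pairing x q"
  by (simp add: poly_pairing_def algebra_simps sum.distrib)

lemma poly_pairing_smult: "poly_pairing x (smult c p) = c * poly_pairing x p"
  by (simp add: poly_pairing_def sum_distrib_left algebra_simps)

lemma poly_pairing_sum: "poly_pairing x (sum h A) = (\<Sum>i\<in>A. poly_pairing x (h i))"
  by (simp add: poly_pairing_def coeff_sum sum_distrib_right sum.swap[of _ A])

lemma poly_pairing_monom: "i < length x \<Longrightarrow> poly_pairing x (monom c i) = c * x ! i"
  by (simp add: poly_pairing_def if_distrib[of "\<lambda>c. c * _"] cong: if_cong)

lemma poly_eq_sum_monom_lessThan:
  assumes "p \<noteq> 0 \<longrightarrow> degree p < n"
  shows "p = (\<Sum>i<n. monom (coeff p i) i)"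
  using assms by (intro poly_eqI) (cases "p = 0", auto simp: coeff_sum coeff_eq_0)

lemma nth_no_boundary_ca_linear_rule:
  assumes "length x = 2 * m" and "k < m"
  shows "no_boundary_ca (2 * m) (Suc m) (linear_rule (Suc m) a) x ! k =
    poly_pairing x (monom 1 k * rule_poly (Suc m) a)"
proof -
  have "monom 1 k * rule_poly (Suc m) a = (\<Sum>i<Suc m. monom (a i) (k + i))"
    by (simp only: rule_poly_def sum_distrib_left mult_monom mult_1_left)
  \<comment> \<open>Since \<open>k < m\<close>, the indices \<open>k + i\<close> with
    \<open>i \<le> m\<close> stay below \<open>2 * m\<close>, so every monomial reads an actual
    cell.\<close>
  then have "poly_pairing x (monom 1 k * rule_poly (Suc m) a) = (\<Sum>i<Suc m. a i * x ! (k + i))"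
    using assms by (simp add: poly_pairing_sum poly_pairing_monom del: sum.lessThan_Suc)
  then show ?thesis using assms
    by (simp add: no_boundary_ca_def linear_rule_def del: sum.lessThan_Suc upt_Suc)
qed

text \<open>By linearity, the value at the product is the combination of the \<open>m\<close> output
  cells with the coefficients of \<open>u\<close> as weights.\<close>

lemma no_boundary_ca_eq_imp_poly_pairing_eq:
  assumes len: "length x = 2 * m" "length y = 2 * m"
    and eq: "no_boundary_ca (2 * m) (Suc m) (linear_rule (Suc m) a) x =
      no_boundary_ca (2 * m) (Suc m) (linear_rule (Suc m) a) y"
    and u: "u \<noteq> 0 \<longrightarrow> degree u < m"
  shows "poly_pairing x (u * rule_poly (Suc m) a) = poly_pairing y (u * rule_poly (Suc m) a)"
proof -
  let ?p = "rule_poly (Suc m) a"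
  have "u * ?p = (\<Sum>k<m. smult (coeff u k) (monom 1 k * ?p))"
    by (subst poly_eq_sum_monom_lessThan[OF u])
      (simp add: sum_distrib_right smult_monom flip: mult_smult_left)
  moreover have "poly_pairing x (monom 1 k * ?p) = poly_pairing y (monom 1 k * ?p)" if "k < m" for k
    using that len eq by (simp flip: nth_no_boundary_ca_linear_rule)
  ultimately show ?thesis by (simp add: poly_pairing_sum poly_pairing_smult)
qed

section \<open>Coprimality and joint injectivity of two automata\<close>

lemma coprime_imp_no_boundary_ca_pair_inj:
  fixes a b :: "nat \<Rightarrow> 'a::field"
  assumes cop: "coprime (rule_poly (Suc m) a) (rule_poly (Suc m) b)"
    and nz: "a m \<noteq> 0" "b m \<noteq> 0" and m: "m > 0"
    and len: "length x = 2 * m" "length y = 2 * m"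
    and F: "no_boundary_ca (2 * m) (Suc m) (linear_rule (Suc m) a) x =
      no_boundary_ca (2 * m) (Suc m) (linear_rule (Suc m) a) y"
    and G: "no_boundary_ca (2 * m) (Suc m) (linear_rule (Suc m) b) x =
      no_boundary_ca (2 * m) (Suc m) (linear_rule (Suc m) b) y"
  shows "x = y"
proof (rule nth_equalityI)
  fix i assume i: "i < length x"
  have deg: "degree (rule_poly (Suc m) a) = m" "degree (rule_poly (Suc m) b) = m"
    using nz by (simp_all add: degree_rule_poly)
  \<comment> \<open>The two degrees add up to \<open>2 * m\<close>, the number of cells, so the
    Bezout bound reaches every monomial that reads a cell.\<close>
  have "degree (monom (1::'a) i) < degree (rule_poly (Suc m) a) + degree (rule_poly (Suc m) b)"
    using i len by (simp add: deg degree_monom_eq)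
  then obtain u v where "u * rule_poly (Suc m) a + v * rule_poly (Suc m) b = monom 1 i"
    and "u \<noteq> 0 \<longrightarrow> degree u < m" "degree v < m"
    using coprime_poly_bezout_degree[OF cop] deg m by metis
  then have "poly_pairing x (monom 1 i) = poly_pairing y (monom 1 i)"
    using no_boundary_ca_eq_imp_poly_pairing_eq[OF len F, of u]
      no_boundary_ca_eq_imp_poly_pairing_eq[OF len G, of v]
    by (metis poly_pairing_add)
  then show "x ! i = y ! i" using i len by (simp add: poly_pairing_monom)
qed (use len in simp)

text \<open>Reduction modulo \<open>h\<close> and taking a coefficient are linear, so only the
  values at monomials matter, and these are the entries of the list.\<close>

lemma poly_pairing_coeff_monom_mod:
  fixes h p :: "'a::field poly"
  assumes "p \<noteq> 0 \<longrightarrow> degree p < n"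
  shows "poly_pairing (map (\<lambda>i. coeff (monom 1 i mod h) j) [0..<n]) p = coeff (p mod h) j"
proof -
  have "(\<Sum>i\<in>A. monom (coeff p i) i) mod h = (\<Sum>i\<in>A. smult (coeff p i) (monom 1 i mod h))"
    if "finite A" for A
    using that by induction (simp_all add: poly_mod_add_left smult_monom flip: mod_smult_left)
  then have "p mod h = (\<Sum>i<n. smult (coeff p i) (monom 1 i mod h))"
    using poly_eq_sum_monom_lessThan[OF assms] by (metis finite_lessThan)
  then show ?thesis by (simp add: poly_pairing_def coeff_sum)
qed

lemma not_coprime_imp_no_boundary_ca_pair_not_inj:
  fixes a b :: "nat \<Rightarrow> 'a::field"
  assumes ncop: "\<not> coprime (rule_poly (Suc m) a) (rule_poly (Suc m) b)"
    and nz: "a m \<noteq> 0" "b m \<noteq> 0" and m: "m > 0"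
  obtains x y :: "'a list" where "length x = 2 * m" "length y = 2 * m" "x \<noteq> y"
    "no_boundary_ca (2 * m) (Suc m) (linear_rule (Suc m) a) x =
      no_boundary_ca (2 * m) (Suc m) (linear_rule (Suc m) a) y"
    "no_boundary_ca (2 * m) (Suc m) (linear_rule (Suc m) b) x =
      no_boundary_ca (2 * m) (Suc m) (linear_rule (Suc m) b) y"
proof -
  obtain h where h: "h dvd rule_poly (Suc m) a" "h dvd rule_poly (Suc m) b" "\<not> is_unit h"
    using ncop by (rule not_coprimeE)
  have deg: "degree (rule_poly (Suc m) a) = m" "degree (rule_poly (Suc m) b) = m"
    using nz by (simp_all add: degree_rule_poly)
  then have "rule_poly (Suc m) a \<noteq> 0" using m by auto
  then have "h \<noteq> 0" and le: "degree h \<le> m" using h(1) deg dvd_imp_degree_le[OF h(1)] by auto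
  then have e: "degree h > 0" using h(3) is_unit_iff_degree by blast
  define x where "x = map (\<lambda>i. coeff (monom 1 i mod h) (degree h - 1)) [0..<2 * m]"
  \<comment> \<open>Linear rules send the zero configuration to zeros, so agreeing with it means
    that both automata vanish on \<open>x\<close>.\<close>
  define y where "y = replicate (2 * m) (0::'a)"
  have len: "length x = 2 * m" "length y = 2 * m" by (simp_all add: x_def y_def)
  have "degree h - 1 < 2 * m" using le m by linarith
  \<comment> \<open>As \<open>degree h > 0\<close>, the monomial of degree
    \<open>degree h - 1\<close> is its own remainder modulo \<open>h\<close>, which makes this entry
    1.\<close>
  moreover have "x ! (degree h - 1) = 1" if "degree h - 1 < 2 * m"
    using that e by (simp add: x_def mod_poly_less degree_monom_eq)
  ultimately have "x \<noteq> y" using len by (auto simp: y_def)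
  moreover have "no_boundary_ca (2 * m) (Suc m) (linear_rule (Suc m) c) x =
      no_boundary_ca (2 * m) (Suc m) (linear_rule (Suc m) c) y"
    if c: "h dvd rule_poly (Suc m) c" "degree (rule_poly (Suc m) c) = m" for c
  proof (rule nth_equalityI)
    fix k assume "k < length (no_boundary_ca (2 * m) (Suc m) (linear_rule (Suc m) c) x)"
    then have k: "k < m" using m by (simp add: length_no_boundary_ca)
    let ?p = "monom 1 k * rule_poly (Suc m) c"
    have "degree ?p \<le> k + m"
      using degree_mult_le[of "monom 1 k" "rule_poly (Suc m) c"] c(2) by (simp add: degree_monom_eq)
    \<comment> \<open>The pairing is a coefficient of \<open>?p mod h\<close>, because
      \<open>k + m < 2 * m\<close>, and \<open>h\<close> divides \<open>?p\<close>.\<close>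
    then have "poly_pairing x ?p = 0"
      using k c(1) by (simp add: x_def poly_pairing_coeff_monom_mod)
    moreover have "poly_pairing y ?p = 0" by (simp add: y_def poly_pairing_def)
    ultimately show "no_boundary_ca (2 * m) (Suc m) (linear_rule (Suc m) c) x ! k =
        no_boundary_ca (2 * m) (Suc m) (linear_rule (Suc m) c) y ! k"
      using len k by (simp add: nth_no_boundary_ca_linear_rule)
  qed (use m in \<open>simp add: length_no_boundary_ca\<close>)
  ultimately show ?thesis using that len h(1,2) deg by blast
qed

section \<open>From pairs of squares to pairs of automata\<close>

text \<open>Decoding two indices and concatenating, the map \<open>\<kappa>\<close>, identifies
  index pairs with configurations of length \<open>2 * m\<close>; \<open>\<phi>\<close> cancels
  because it is injective on the outputs.\<close>

lemma inj_on_generated_square_pair_iff: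
  assumes \<phi>: "bij_betw \<phi> {x. length x = m} {1..N}"
    and F: "\<And>x. length (F x) = m" and G: "\<And>x. length (G x) = m"
  shows "inj_on (\<lambda>(i, j). (generated_square m \<phi> F i j, generated_square m \<phi> G i j))
      ({1..N} \<times> {1..N}) \<longleftrightarrow> inj_on (\<lambda>x. (F x, G x)) {x. length x = 2 * m}"
proof -
  define \<psi> where "\<psi> = inv_into {x. length x = m} \<phi>"
  define \<kappa> where "\<kappa> = (\<lambda>(i, j). \<psi> i @ \<psi> j)"
  have \<psi>: "bij_betw \<psi> {1..N} {x. length x = m}"
    unfolding \<psi>_def by (rule bij_betw_inv_into[OF \<phi>])
  have \<psi>_image: "\<psi> ` {1..N} = {x. length x = m}" using \<psi> by (simp add: bij_betw_def)
  have \<psi>_len: "length (\<psi> i) = m" if "i \<in> {1..N}" for i using bij_betw_apply[OF \<psi> that] by simp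
  have \<kappa>_inj: "inj_on \<kappa> ({1..N} \<times> {1..N})"
    using \<psi>_len inj_on_eq_iff[OF bij_betw_imp_inj_on[OF \<psi>]]
    by (auto simp: \<kappa>_def intro!: inj_onI)
  have "x \<in> \<kappa> ` ({1..N} \<times> {1..N})" if "length x = 2 * m" for x
  proof -
    have "take m x \<in> \<psi> ` {1..N}" "drop m x \<in> \<psi> ` {1..N}" using that unfolding \<psi>_image by simp_all
    then obtain i j where "i \<in> {1..N}" "j \<in> {1..N}" "take m x = \<psi> i" "drop m x = \<psi> j" by blast
    then have "x = \<kappa> (i, j)" unfolding \<kappa>_def by (metis append_take_drop_id case_prod_conv)
    then show ?thesis using \<open>i \<in> {1..N}\<close> \<open>j \<in> {1..N}\<close> by blast
  qed
  then have \<kappa>_image: "\<kappa> ` ({1..N} \<times> {1..N}) = {x. length x = 2 * m}"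
    using \<psi>_len by (auto simp: \<kappa>_def)
  have \<phi>_eq: "\<phi> x = \<phi> y \<longleftrightarrow> x = y" if "length x = m" "length y = m" for x y
    using bij_betw_imp_inj_on[OF \<phi>] that by (auto simp: inj_on_def)
  have "inj_on (\<lambda>(i, j). (generated_square m \<phi> F i j, generated_square m \<phi> G i j))
      ({1..N} \<times> {1..N}) \<longleftrightarrow> inj_on ((\<lambda>x. (F x, G x)) \<circ> \<kappa>) ({1..N} \<times> {1..N})"
    by (simp add: inj_on_def generated_square_def Let_def \<kappa>_def \<phi>_eq F G flip: \<psi>_def)
  also have "\<dots> \<longleftrightarrow> inj_on (\<lambda>x. (F x, G x)) {x. length x = 2 * m}"
    by (simp only: comp_inj_on_iff[OF \<kappa>_inj, symmetric] \<kappa>_image)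
  finally show ?thesis .
qed

theorem theorem1:
  fixes a b :: "nat \<Rightarrow> 'a :: {field, finite}"
    and f g :: "'a list \<Rightarrow> 'a"
    and F G :: "'a list \<Rightarrow> 'a list"
    and q d :: nat
    and \<phi> :: "'a list \<Rightarrow> nat"
  assumes "CARD('a) = q"
    and "d \<ge> 2"
    and "f = linear_rule d a" and "bipermutive d f"
    and "g = linear_rule d b" and "bipermutive d g"
    and "F = no_boundary_ca (2 * (d - 1)) d f"
    and "G = no_boundary_ca (2 * (d - 1)) d g"
    and "bij_betw \<phi> {x. length x = d - 1} {1..q ^ (d - 1)}"
  shows "orthogonal_latin_squares (q ^ (d - 1))
           (generated_square (d - 1) \<phi> F) (generated_square (d - 1) \<phi> G)
         \<longleftrightarrow> coprime (rule_poly d a) (rule_poly d b)"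
proof -
  define m where "m = d - 1"
  have d: "d = Suc m" and m: "m > 0" using assms(2) by (auto simp: m_def)
  \<comment> \<open>These leading coefficients fix the degree of both rule polynomials at exactly
    \<open>m\<close>.\<close>
  have nz: "a m \<noteq> 0" "b m \<noteq> 0"
    using assms(2-6) by (auto simp: bipermutive_linear_rule_iff m_def)
  have F: "F = no_boundary_ca (2 * m) (Suc m) (linear_rule (Suc m) a)"
    and G: "G = no_boundary_ca (2 * m) (Suc m) (linear_rule (Suc m) b)"
    using assms by (simp_all add: d)
  \<comment> \<open>Bipermutivity makes both squares Latin, so orthogonality reduces to injectivity
    of the pair map.\<close>
  have "latin_square (q ^ m) (generated_square m \<phi> F)"
    "latin_square (q ^ m) (generated_square m \<phi> G)"
    unfolding assms(7,8) m_def using assms(2,4,6,9) by (intro latin_square_generated_square; simp)+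
  moreover have "inj_on (\<lambda>(i, j). (generated_square m \<phi> F i j, generated_square m \<phi> G i j))
      ({1..q ^ m} \<times> {1..q ^ m}) \<longleftrightarrow> inj_on (\<lambda>x. (F x, G x)) {x. length x = 2 * m}"
    using m
    by (intro inj_on_generated_square_pair_iff assms(9)[folded m_def])
      (simp_all add: F G length_no_boundary_ca)
  moreover have "inj_on (\<lambda>x. (F x, G x)) {x. length x = 2 * m} \<longleftrightarrow>
      coprime (rule_poly (Suc m) a) (rule_poly (Suc m) b)"
  proof
    assume inj: "inj_on (\<lambda>x. (F x, G x)) {x. length x = 2 * m}"
    show "coprime (rule_poly (Suc m) a) (rule_poly (Suc m) b)"
    proof (rule ccontr)
      assume "\<not> coprime (rule_poly (Suc m) a) (rule_poly (Suc m) b)"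
      then obtain x y where "length x = 2 * m" "length y = 2 * m" "x \<noteq> y" "F x = F y" "G x = G y"
        unfolding F G by (rule not_coprime_imp_no_boundary_ca_pair_not_inj[of m a b, OF _ nz m])
      then show False using inj by (auto simp: inj_on_def)
    qed
  next
    assume "coprime (rule_poly (Suc m) a) (rule_poly (Suc m) b)"
    then show "inj_on (\<lambda>x. (F x, G x)) {x. length x = 2 * m}"
      using coprime_imp_no_boundary_ca_pair_inj[of m a b, OF _ nz m] by (auto simp: inj_on_def F G)
  qed
  ultimately show ?thesis by (simp add: orthogonal_latin_squares_def d)
qed

end
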